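(* Let $(V,\|\cdot\|_V)$ and $(W,\|\cdot\|_W)$ be separable $\mathbb{R}$-Banach spaces, let $T\in(0,\infty)$, $F\in C(V,W)$, $o\in C([0,T],V)$, let $S\colon(0,T)\to L(W,V)$ be a $\mathcal{B}((0,T))/\mathcal{B}(L(W,V))$-measurable function, let $\mathcal{S}\colon[0,T]\to L(V)$ be a $\mathcal{B}([0,T])/\mathcal{B}(L(V))$-measurable function, and assume for all $r\in[0,\infty)$, $t_1\in[0,T)$, $t_2\in(0,T-t_1)$, $v\in V$ that $([0,T]\ni t\mapsto\mathcal{S}_t v\in V)\in C([0,T],V)$, $S_{t_1+t_2}=\mathcal{S}_{t_1}S_{t_2}$, and $$\sup\Big(\Big\{\tfrac{\|F(v)-F(w)\|_W}{\|v-w\|_V}\colon v,w\in V,\ v\neq w,\ \|v\|_V+\|w\|_V\le r\Big\}\cup\{0\}\Big)+\inf_{\alpha,\rho\in(0,1)}\ \sup_{s\in(0,T),\,t\in(s,T)}\Big[s^{\alpha}\big(\|S_s\|_{L(W,V)}+\|S_t-S_s\|_{L(W,V)}\,|t-s|^{-\rho}\big)\Big]<\infty.$$ Then there exists a unique convex set $J\subseteq[0,T]$ with $\{0\}\subsetneq J$ such that (i) there exists a unique $x\in C(J,V)$ which satisfies for all $t\in J$ that $$\int_0^t\|S_{t-s}F(x_s)\|_V\,ds<\limsup_{s\nearrow\sup(J)}\Big[\frac{1}{T-s}+\|x_s\|_V\Big]=\infty$$ and $x_t=\int_0^t S_{t-s}F(x_s)\,ds+o_t$, (ii) for all convex sets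 $I\subseteq[0,T]$ and all $y\in C(I,V)$ with $I\supseteq J$, $\forall\,t\in I\colon\int_0^t\|S_{t-s}F(y_s)\|_V\,ds<\infty$, and $\forall\,t\in I\colon y_t=\int_0^t S_{t-s}F(y_s)\,ds+o_t$ it holds that $x=y$, where $x$ is the function from (i), and (iii) for all $y\in C(J,V)$ with $\forall\,t\in J\colon\int_0^t\|S_{t-s}F(y_s)\|_V\,ds<\infty$, $\forall\,t\in J\colon y_t=\int_0^t S_{t-s}F(y_s)\,ds+o_t$, and $\limsup_{s\nearrow\sup(J)}\|y_s\|_V<\infty$ it holds that $J=[0,T]$.
   Context: $C(X,Y)$ is the set of continuous functions from $X$ to $Y$. $L(W,V)$ is the Banach space of bounded linear operators from $W$ to $V$ with the operator norm, and $L(V)=L(V,V)$. $\mathcal{B}(X)$ is the Borel $\sigma$-algebra of $X$ (for $L(W,V)$ and $L(V)$: with respect to the operator norm topology). $V$-valued integrals are Bochner integrals. For functions of time, $x_t$ means $x(t)$, $S_t=S(t)$, $\mathcal{S}_t=\mathcal{S}(t)$, $o_t=o(t)$. The notation $\limsup_{s\nearrow\sup(J)}$ is the left-sided limit superior over $s\in J$, $s<\sup(J)$. Equality $x=y$ in (ii) is equality of functions (including equality of domains, so in particular $I=J$). *)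

theory Defs
  imports "HOL-Analysis.Analysis"
begin

text \<open>
  The set $C(X,Y)$ of continuous functions with domain $X$ and values in $Y$. A function with
  domain $X$ is represented by a total function that is undefined outside $X$, so two members of
  \<open>cont_maps X Y\<close> are equal iff they agree on $X$.
\<close>

definition cont_maps ::
  "'a::topological_space set \<Rightarrow> 'b::topological_space set \<Rightarrow> ('a \<Rightarrow> 'b) set"
  where "cont_maps X Y = {f \<in> X \<rightarrow>\<^sub>E Y. continuous_on X f}"

text \<open>
  The integrals $\int_0^t \|S_{t-s} F(x_s)\|\,ds$ and $\int_0^t S_{t-s} F(x_s)\,ds$. They are taken
  over the open interval because $S$ is given on $(0,T)$ only. The first one is a Lebesgue integral
  with values in $[0,\infty]$. The second one is a Bochner integral; it has the conventional value
  $0$ if the integrand is not integrable, so it is always to be used together with finiteness of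
  the first one.
\<close>

definition conv_norm_integral ::
  "(real \<Rightarrow> 'w::real_normed_vector \<Rightarrow>\<^sub>L 'v::real_normed_vector) \<Rightarrow> ('v \<Rightarrow> 'w) \<Rightarrow> (real \<Rightarrow> 'v) \<Rightarrow> real \<Rightarrow> ennreal"
  where "conv_norm_integral S F x t =
    (\<integral>\<^sup>+s\<in>{0<..<t}. ennreal (norm (blinfun_apply (S (t - s)) (F (x s)))) \<partial>lborel)"

definition conv_integral ::
  "(real \<Rightarrow> 'w::real_normed_vector \<Rightarrow>\<^sub>L 'v::{banach, second_countable_topology}) \<Rightarrow> ('v \<Rightarrow> 'w) \<Rightarrow> (real \<Rightarrow> 'v) \<Rightarrow> real \<Rightarrow> 'v"
  where "conv_integral S F x t =
    (LINT s:{0<..<t}|lborel. blinfun_apply (S (t - s)) (F (x s)))"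

text \<open>
  The limit superior $\limsup_{s\nearrow\sup(J)} g(s)$, valued in $[0,\infty]$; it is meant for $g$
  that are nonnegative on $J\cap(-\infty,\sup(J))$, since negative values are truncated to $0$.
\<close>

definition limsup_left_Sup :: "real set \<Rightarrow> (real \<Rightarrow> real) \<Rightarrow> ennreal"
  where "limsup_left_Sup J g =
    Limsup (at (Sup J) within {s \<in> J. s < Sup J}) (\<lambda>s. ennreal (g s))"

definition maximal_solution ::
  "real \<Rightarrow> (real \<Rightarrow> 'w::real_normed_vector \<Rightarrow>\<^sub>L 'v::{banach, second_countable_topology}) \<Rightarrow> ('v \<Rightarrow> 'w)
    \<Rightarrow> (real \<Rightarrow> 'v) \<Rightarrow> real set \<Rightarrow> (real \<Rightarrow> 'v) \<Rightarrow> bool"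
  where "maximal_solution T S F f J x \<longleftrightarrow>
    x \<in> cont_maps J UNIV \<and>
    (\<forall>t\<in>J.
      conv_norm_integral S F x t < limsup_left_Sup J (\<lambda>s. 1 / (T - s) + norm (x s)) \<and>
      limsup_left_Sup J (\<lambda>s. 1 / (T - s) + norm (x s)) = \<infinity> \<and>
      x t = conv_integral S F x t + f t)"

end

theory Submission
  imports Defs
begin

text \<open>
  The hypotheses give \<open>norm (S s) \<le> C * s powr - \<alpha>\<close> with \<open>\<alpha> < 1\<close> and, by
  the weighted Hoelder bound, continuity of \<open>S\<close> in operator norm on \<open>{0<..<T}\<close>. Hence in a
  norm weighted by \<open>exp (- (\<kappa> * t))\<close> with \<open>\<kappa>\<close> large the convolution with
  \<open>S\<close> is a contraction, which yields uniqueness for the locally Lipschitz \<open>F\<close> and a solution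
  \<open>z\<close> on all of \<open>{0..T}\<close> when \<open>F\<close> is truncated outside the ball of radius
  \<open>R\<close>. A solution of the original equation that is bounded by \<open>R\<close> coincides with
  \<open>z\<close>, and \<open>z\<close> solves the original equation as long as it is bounded by \<open>R\<close>.
  Therefore the set \<open>J\<close> of all times \<open>t\<close> such that a solution exists on
  \<open>{0..t}\<close> is relatively open in \<open>{0..T}\<close>, and it contains its supremum if the solution is
  bounded.
\<close>

section \<open>Boundedness, integrable powers and the convolution integrand\<close>

lemma continuous_on_imp_norm_le:
  fixes g :: "real \<Rightarrow> 'b::real_normed_vector"
  assumes "continuous_on {0..t} g"
  obtains M where "0 \<le> M" and "\<And>s. s \<in> {0..t} \<Longrightarrow> norm (g s) \<le> M"
proof -
  have "bounded (g ` {0..t})"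
    by (intro compact_imp_bounded compact_continuous_image assms compact_Icc)
  then obtain M where "0 < M" "\<forall>x\<in>g ` {0..t}. norm x \<le> M"
    by (auto simp: bounded_pos)
  with that[of M] show thesis
    by auto
qed

lemma set_integrable_powr_neg:
  fixes a T :: real
  assumes "a < 1" and "0 \<le> T"
  shows "set_integrable lborel {0<..<T} (\<lambda>s. s powr - a)"
proof -
  have "(\<lambda>s. s powr - a) integrable_on {0..T}"
    using has_integral_powr_from_0[of "- a" T] assms by (auto simp: integrable_on_def)
  then have "(\<lambda>s. s powr - a) absolutely_integrable_on {0..T}"
    by (rule nonnegative_absolutely_integrable_1) simp
  then have "(\<lambda>s. s powr - a) absolutely_integrable_on {0<..<T}"
    by (rule set_integrable_subset) auto
  \<comment> \<open>Absolute integrability refers to the completed measure; Borel measurability of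
    the integrand brings it back to \<open>lborel\<close>.\<close>
  moreover have "(\<lambda>s. indicator {0<..<T} s *\<^sub>R s powr - a) \<in> borel_measurable borel"
    by (rule borel_measurable_continuous_on_indicator) (auto intro!: continuous_intros)
  ultimately show ?thesis
    unfolding set_integrable_def by (simp add: integrable_completion)
qed

text \<open>The argument of \<open>S\<close> instead of that of \<open>g\<close> is the integration variable, so that all integrands
  have the same dominating function \<open>s powr - \<alpha>\<close>.\<close>

definition conv_integrand ::
  "(real \<Rightarrow> 'w::real_normed_vector \<Rightarrow>\<^sub>L 'v::real_normed_vector) \<Rightarrow> (real \<Rightarrow> 'w) \<Rightarrow> real \<Rightarrow> real \<Rightarrow> 'v"
  where "conv_integrand S g t s = indicator {0<..<t} s *\<^sub>R blinfun_apply (S s) (g (t - s))"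

lemma conv_integrand_reflect:
  "conv_integrand S g t (t - s) = indicator {0<..<t} s *\<^sub>R blinfun_apply (S (t - s)) (g s)"
  by (auto simp: conv_integrand_def indicator_def)

lemma conv_integral_eq:
  "conv_integral S F x t = (\<integral>s. conv_integrand S (\<lambda>s. F (x s)) t s \<partial>lborel)"
  using lborel_integral_real_affine[of "-1" "conv_integrand S (\<lambda>s. F (x s)) t" t]
  by (simp add: conv_integral_def set_lebesgue_integral_def conv_integrand_reflect)

text \<open>Written with \<open>t + - 1 * s\<close> to match the affine substitution rule that
  \<open>conv_norm_integral_finite\<close> applies to the integrand.\<close>

lemma conv_norm_integral_eq:
  "conv_norm_integral S F x t
    = (\<integral>\<^sup>+s. norm (conv_integrand S (\<lambda>s. F (x s)) t (t + - 1 * s)) \<partial>lborel)"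
  unfolding conv_norm_integral_def
  by (intro nn_integral_cong) (simp add: conv_integrand_reflect indicator_def)

section \<open>Convolution with a singular kernel\<close>

text \<open>The form in which the infimum hypothesis on \<open>S\<close> enters: continuity gives
  measurable integrands, and the bound with \<open>\<alpha> < 1\<close> gives an integrable
  singularity at 0.\<close>

locale singular_kernel =
  fixes S :: "real \<Rightarrow> 'w::{banach, second_countable_topology} \<Rightarrow>\<^sub>L 'v::{banach, second_countable_topology}"
    and T C \<alpha> :: real
  assumes T_pos: "0 < T"
    and \<alpha>_less_1: "\<alpha> < 1"
    and S_continuous: "continuous_on {0<..<T} S"
    and norm_S_le: "\<And>s. s \<in> {0<..<T} \<Longrightarrow> norm (S s) \<le> C * s powr - \<alpha>"
begin

lemma C_nonneg: "0 \<le> C"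
proof -
  have "0 \<le> C * (T / 2) powr - \<alpha>"
    by (rule order_trans[OF norm_ge_zero norm_S_le]) (use T_pos in auto)
  then show ?thesis
    using T_pos by (simp add: zero_le_mult_iff)
qed

lemma measurable_conv_integrand:
  assumes "t \<le> T" and "continuous_on {0..t} g"
  shows "conv_integrand S g t \<in> borel_measurable lborel"
proof -
  have "continuous_on {0<..<t} S"
    using S_continuous by (rule continuous_on_subset) (use assms in auto)
  moreover have "continuous_on {0<..<t} (\<lambda>s. g (t - s))"
    by (rule continuous_on_compose2[OF assms(2)]) (auto intro!: continuous_intros)
  ultimately have "continuous_on {0<..<t} (\<lambda>s. blinfun_apply (S s) (g (t - s)))"
    by (intro continuous_intros)
  then show ?thesis
    unfolding conv_integrand_def by (simp add: borel_measurable_continuous_on_indicator)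
qed

text \<open>The majorant carries the indicator of \<open>{0<..<T}\<close> rather than of
  \<open>{0<..<t}\<close>, so it does not depend on \<open>t\<close> and can serve in dominated
  convergence as \<open>t\<close> varies.\<close>

lemma norm_conv_integrand_le:
  assumes "t \<in> {0..T}" and "\<And>s. s \<in> {0..t} \<Longrightarrow> norm (g s) \<le> M"
  shows "norm (conv_integrand S g t s) \<le> C * M * (indicator {0<..<T} s *\<^sub>R s powr - \<alpha>)"
proof (cases "s \<in> {0<..<t}")
  case True
  then have "norm (S s) * norm (g (t - s)) \<le> (C * s powr - \<alpha>) * M"
    using assms by (intro mult_mono norm_S_le) (auto simp: C_nonneg)
  then show ?thesis
    using True assms(1) norm_blinfun[of "S s" "g (t - s)"]
    by (simp add: conv_integrand_def mult_ac)
next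
  case False
  have "0 \<le> M"
    using assms(1) order_trans[OF norm_ge_zero assms(2)[of 0]] by simp
  with False show ?thesis
    by (simp add: conv_integrand_def C_nonneg)
qed

lemma integrable_powr: "integrable lborel (\<lambda>s. indicator {0<..<T} s *\<^sub>R s powr - \<alpha>)"
  using set_integrable_powr_neg[OF \<alpha>_less_1] T_pos by (simp add: set_integrable_def)

lemma integrable_conv_integrand:
  assumes "t \<in> {0..T}" and "continuous_on {0..t} g"
  shows "integrable lborel (conv_integrand S g t)"
proof -
  obtain M where "\<And>s. s \<in> {0..t} \<Longrightarrow> norm (g s) \<le> M"
    using continuous_on_imp_norm_le[OF assms(2)] by metis
  note bound = norm_conv_integrand_le[OF assms(1) this]
  show ?thesis
  proof (rule Bochner_Integration.integrable_bound)
    show "integrable lborel (\<lambda>s. C * M * (indicator {0<..<T} s *\<^sub>R s powr - \<alpha>))"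
      using integrable_powr by simp
    show "conv_integrand S g t \<in> borel_measurable lborel"
      using assms by (intro measurable_conv_integrand) auto
    show "AE s in lborel. norm (conv_integrand S g t s)
        \<le> norm (C * M * (indicator {0<..<T} s *\<^sub>R s powr - \<alpha>))"
      unfolding real_norm_def by (intro AE_I2 order_trans[OF bound] abs_ge_self)
  qed
qed

lemma conv_norm_integral_finite:
  assumes "t \<in> {0..T}" and "continuous_on {0..t} (\<lambda>s. G (x s))"
  shows "conv_norm_integral S G x t < \<infinity>"
  using lborel_integrable_real_affine[OF integrable_conv_integrand[OF assms], of "-1" t]
  unfolding conv_norm_integral_eq integrable_iff_bounded by simp

text \<open>Dominated convergence along sequences of times, with the common majorant from
  \<open>norm_conv_integrand_le\<close>.\<close>

lemma continuous_on_conv: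
  assumes "continuous_on {0..T} g"
  shows "continuous_on {0..T} (\<lambda>t. \<integral>s. conv_integrand S g t s \<partial>lborel)"
  unfolding continuous_on_sequentially comp_def
proof safe
  fix X t
  assume X: "\<forall>n. X n \<in> {0..T}" and t: "t \<in> {0..T}" and lim: "X \<longlonglongrightarrow> t"
  obtain M where M: "\<And>s. s \<in> {0..T} \<Longrightarrow> norm (g s) \<le> M"
    using continuous_on_imp_norm_le[OF assms] by metis
  show "(\<lambda>n. \<integral>s. conv_integrand S g (X n) s \<partial>lborel) \<longlonglongrightarrow> (\<integral>s. conv_integrand S g t s \<partial>lborel)"
  proof (rule integral_dominated_convergence)
    show "integrable lborel (\<lambda>s. C * M * (indicator {0<..<T} s *\<^sub>R s powr - \<alpha>))"
      using integrable_powr by simp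
    show "conv_integrand S g t \<in> borel_measurable lborel"
      using t by (intro measurable_conv_integrand continuous_on_subset[OF assms]) auto
    show "conv_integrand S g (X n) \<in> borel_measurable lborel" for n
      using X by (intro measurable_conv_integrand continuous_on_subset[OF assms]) auto
    show "AE s in lborel. norm (conv_integrand S g (X n) s)
        \<le> C * M * (indicator {0<..<T} s *\<^sub>R s powr - \<alpha>)" for n
      using X M by (intro AE_I2 norm_conv_integrand_le) (auto intro: order_trans)
    show "AE s in lborel. (\<lambda>n. conv_integrand S g (X n) s) \<longlonglongrightarrow> conv_integrand S g t s"
      \<comment> \<open>Pointwise convergence may fail at \<open>s = t\<close>, where the indicator
        of \<open>{0<..<t}\<close> jumps; this point is a null set.\<close>
      using AE_lborel_singleton[of t]
    proof eventually_elim
      case (elim s)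
      consider "s \<le> 0" | "0 < s" "s < t" | "t < s"
        using elim by linarith
      then show ?case
      proof cases
        case 1
        then show ?thesis
          by (simp add: conv_integrand_def)
      next
        case 2
        have ev: "\<forall>\<^sub>F n in sequentially. s < X n"
          using lim 2 by (simp add: order_tendstoD)
        have "(\<lambda>n. g (X n - s)) \<longlonglongrightarrow> g (t - s)"
        proof (rule continuous_on_tendsto_compose[OF assms])
          show "(\<lambda>n. X n - s) \<longlonglongrightarrow> t - s"
            using lim by (intro tendsto_intros)
          show "\<forall>\<^sub>F n in sequentially. X n - s \<in> {0..T}"
            using ev
          proof eventually_elim
            case (elim n)
            then show ?case
              using X[rule_format, of n] 2 by auto
          qed
        qed (use 2 t in auto)
        then have "(\<lambda>n. S s (g (X n - s))) \<longlonglongrightarrow> S s (g (t - s))"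
          by (intro tendsto_intros)
        then have "(\<lambda>n. S s (g (X n - s))) \<longlonglongrightarrow> conv_integrand S g t s"
          using 2 by (simp add: conv_integrand_def)
        then show ?thesis
          by (rule Lim_transform_eventually)
            (use ev in eventually_elim, use 2 in \<open>auto simp: conv_integrand_def\<close>)
      next
        case 3
        then have "\<forall>\<^sub>F n in sequentially. X n < s"
          using lim by (simp add: order_tendstoD)
        then have "\<forall>\<^sub>F n in sequentially. conv_integrand S g t s = conv_integrand S g (X n) s"
          by eventually_elim (use 3 in \<open>auto simp: conv_integrand_def\<close>)
        then show ?thesis
          by (rule Lim_transform_eventually[rotated]) simp
      qed
    qed
  qed
qed

section \<open>Exponential weights\<close>

text \<open>The Laplace transform, at \<open>\<kappa>\<close>, of the power kernel cut off at
  \<open>T\<close>.\<close>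

definition exp_kernel_integral :: "real \<Rightarrow> real"
  where "exp_kernel_integral \<kappa>
    = (\<integral>s. indicator {0<..<T} s *\<^sub>R s powr - \<alpha> * exp (- (\<kappa> * s)) \<partial>lborel)"

lemma measurable_exp_kernel:
  "(\<lambda>s. indicator {0<..<T} s *\<^sub>R s powr - \<alpha> * exp (- (\<kappa> * s))) \<in> borel_measurable lborel"
  using borel_measurable_integrable[OF integrable_powr] by measurable

lemma integrable_exp_kernel:
  assumes "0 \<le> \<kappa>"
  shows "integrable lborel (\<lambda>s. indicator {0<..<T} s *\<^sub>R s powr - \<alpha> * exp (- (\<kappa> * s)))"
proof (rule Bochner_Integration.integrable_bound[OF integrable_powr measurable_exp_kernel])
  show "AE s in lborel. norm (indicator {0<..<T} s *\<^sub>R s powr - \<alpha> * exp (- (\<kappa> * s)))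
      \<le> norm (indicator {0<..<T} s *\<^sub>R s powr - \<alpha>)"
    using assms by (auto simp: indicator_def mult_left_le)
qed

text \<open>Dominated convergence along integer \<open>\<kappa>\<close>: the exponential factor
  tends to 0 at every \<open>s > 0\<close>, and the power kernel itself is the majorant.\<close>

lemma exp_kernel_integral_small:
  assumes "0 < \<epsilon>"
  obtains \<kappa> where "0 \<le> \<kappa>" and "exp_kernel_integral \<kappa> < \<epsilon>"
proof -
  have "(\<lambda>n. exp_kernel_integral (real n)) \<longlonglongrightarrow> integral\<^sup>L lborel (\<lambda>s::real. 0 :: real)"
    unfolding exp_kernel_integral_def
  proof (rule integral_dominated_convergence[OF _ measurable_exp_kernel integrable_powr])
    show "AE s in lborel. (\<lambda>n. indicator {0<..<T} s *\<^sub>R s powr - \<alpha> * exp (- (real n * s))) \<longlonglongrightarrow> 0"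
    proof (rule AE_I2)
      fix s :: real
      show "(\<lambda>n. indicator {0<..<T} s *\<^sub>R s powr - \<alpha> * exp (- (real n * s))) \<longlonglongrightarrow> 0"
      proof (cases "0 < s")
        case True
        then have "(\<lambda>n. exp (- s) ^ n) \<longlonglongrightarrow> 0"
          by (intro LIMSEQ_realpow_zero) auto
        then have "(\<lambda>n. exp (- (real n * s))) \<longlonglongrightarrow> 0"
          by (simp add: exp_of_nat_mult[symmetric])
        then show ?thesis
          by (rule tendsto_mult_right_zero)
      qed simp
    qed
    show "AE s in lborel. norm (indicator {0<..<T} s *\<^sub>R s powr - \<alpha> * exp (- (real n * s)))
        \<le> indicator {0<..<T} s *\<^sub>R s powr - \<alpha>" for n
      by (auto simp: indicator_def mult_left_le)
  qed simp
  then have "\<forall>\<^sub>F n in sequentially. exp_kernel_integral (real n) < \<epsilon>"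
    using assms by (simp add: order_tendstoD)
  then obtain n :: nat where "exp_kernel_integral (real n) < \<epsilon>"
    by (auto simp: eventually_sequentially)
  with that[of "real n"] show thesis
    by simp
qed

lemma exp_kernel_integral_nonneg: "0 \<le> exp_kernel_integral \<kappa>"
  unfolding exp_kernel_integral_def by (intro integral_nonneg_AE AE_I2) simp

text \<open>Splitting \<open>exp (\<kappa> * (t - s))\<close> into \<open>exp (\<kappa> * t)\<close>
  and \<open>exp (- (\<kappa> * s))\<close> leaves the Laplace transform of the kernel. Thus in the
  norm weighted by \<open>exp (- (\<kappa> * t))\<close> the convolution has Lipschitz constant
  \<open>C * exp_kernel_integral \<kappa>\<close>.\<close>

lemma norm_conv_diff_le:
  assumes t: "t \<in> {0..T}" and g: "continuous_on {0..t} g" and h: "continuous_on {0..t} h"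
    and "0 \<le> \<kappa>" and D: "\<And>s. s \<in> {0..t} \<Longrightarrow> norm (g s - h s) \<le> D * exp (\<kappa> * s)"
  shows "norm ((\<integral>s. conv_integrand S g t s \<partial>lborel) - (\<integral>s. conv_integrand S h t s \<partial>lborel))
    \<le> C * exp_kernel_integral \<kappa> * D * exp (\<kappa> * t)"
proof -
  have "0 \<le> D"
    using t order_trans[OF norm_ge_zero D[of 0]] by simp
  have "norm ((\<integral>s. conv_integrand S g t s \<partial>lborel) - (\<integral>s. conv_integrand S h t s \<partial>lborel))
      = norm (\<integral>s. conv_integrand S g t s - conv_integrand S h t s \<partial>lborel)"
    using integrable_conv_integrand[OF t] g h by simp
  also have "\<dots> \<le> (\<integral>s. C * D * exp (\<kappa> * t)
      * (indicator {0<..<T} s *\<^sub>R s powr - \<alpha> * exp (- (\<kappa> * s))) \<partial>lborel)"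
  proof (rule Bochner_Integration.integral_norm_bound_integral)
    fix s
    show "norm (conv_integrand S g t s - conv_integrand S h t s) \<le> C * D * exp (\<kappa> * t)
        * (indicator {0<..<T} s *\<^sub>R s powr - \<alpha> * exp (- (\<kappa> * s)))"
    proof (cases "s \<in> {0<..<t}")
      case True
      have "norm (S s) * norm (g (t - s) - h (t - s))
          \<le> (C * s powr - \<alpha>) * (D * exp (\<kappa> * (t - s)))"
        using True t by (intro mult_mono norm_S_le D) (auto simp: C_nonneg)
      also have "\<dots> = C * D * exp (\<kappa> * t) * (s powr - \<alpha> * exp (- (\<kappa> * s)))"
        by (simp add: right_diff_distrib exp_diff exp_minus field_simps)
      finally show ?thesis
        using True t norm_blinfun[of "S s" "g (t - s) - h (t - s)"]
        by (simp add: conv_integrand_def blinfun.diff_right)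
    next
      case False
      then show ?thesis
        using \<open>0 \<le> D\<close> by (simp add: conv_integrand_def C_nonneg)
    qed
  qed (use integrable_conv_integrand[OF t] g h integrable_exp_kernel[OF \<open>0 \<le> \<kappa>\<close>] in auto)
  also have "\<dots> = C * exp_kernel_integral \<kappa> * D * exp (\<kappa> * t)"
    by (simp add: exp_kernel_integral_def mult_ac)
  finally show ?thesis .
qed

end

section \<open>Solutions of the integral equation and truncation\<close>

text \<open>Nothing is required of \<open>y\<close> outside \<open>I\<close>, so one function can be
  restricted to subintervals unchanged. Integrability of the integrand is not recorded; it comes
  from continuity through \<open>integrable_conv_integrand\<close>.\<close>

definition mild_solution ::
  "(real \<Rightarrow> 'w::real_normed_vector \<Rightarrow>\<^sub>L 'v::{banach, second_countable_topology}) \<Rightarrow> ('v \<Rightarrow> 'w)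
    \<Rightarrow> (real \<Rightarrow> 'v) \<Rightarrow> real set \<Rightarrow> (real \<Rightarrow> 'v) \<Rightarrow> bool"
  where "mild_solution S F f I y \<longleftrightarrow>
    continuous_on I y \<and> (\<forall>t\<in>I. y t = conv_integral S F y t + f t)"

lemma mild_solution_subset:
  "mild_solution S F f I y \<Longrightarrow> J \<subseteq> I \<Longrightarrow> mild_solution S F f J y"
  unfolding mild_solution_def by (auto intro: continuous_on_subset)

lemma conv_integral_cong:
  assumes "\<And>s. s \<in> {0<..<t} \<Longrightarrow> F (x s) = G (y s)"
  shows "conv_integral S F x t = conv_integral S G y t"
  unfolding conv_integral_def set_lebesgue_integral_def
  using assms by (intro Bochner_Integration.integral_cong) (auto simp: indicator_def)

text \<open>The equation at \<open>t\<close> sees only values on \<open>{0<..<t}\<close> and at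
  \<open>t\<close>. This allows exchanging \<open>F\<close> with its truncation along a solution
  that stays in the ball.\<close>

lemma mild_solution_cong:
  assumes "mild_solution S F f {0..\<tau>} y"
    and "\<And>s. s \<in> {0..\<tau>} \<Longrightarrow> z s = y s" and "\<And>s. s \<in> {0..\<tau>} \<Longrightarrow> G (y s) = F (y s)"
  shows "mild_solution S G f {0..\<tau>} z"
  unfolding mild_solution_def
proof safe
  show "continuous_on {0..\<tau>} z"
    using assms(1) continuous_on_cong[of "{0..\<tau>}" "{0..\<tau>}" z y, OF refl assms(2)]
    unfolding mild_solution_def by (metis (no_types))
  fix t assume t: "t \<in> {0..\<tau>}"
  then have "conv_integral S G z t = conv_integral S F y t"
    using assms(2,3) by (intro conv_integral_cong) auto
  then show "z t = conv_integral S G z t + f t"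
    using assms(1,2) t by (simp add: mild_solution_def)
qed

text \<open>The \<open>max\<close> covers points inside and outside the ball by one formula whose
  denominator is at least \<open>R\<close>.\<close>

definition radial_retraction :: "real \<Rightarrow> 'a::real_normed_vector \<Rightarrow> 'a"
  where "radial_retraction R v = (R / max R (norm v)) *\<^sub>R v"

lemma radial_retraction_id: "0 < R \<Longrightarrow> norm v \<le> R \<Longrightarrow> radial_retraction R v = v"
  by (simp add: radial_retraction_def max_absorb1)

lemma norm_radial_retraction_le: "0 < R \<Longrightarrow> norm (radial_retraction R v) \<le> R"
  by (simp add: radial_retraction_def max_def field_simps)

text \<open>The difference splits into a scaled \<open>v - w\<close> and a change of the scaling
  factor applied to \<open>w\<close>. Each part is at most \<open>norm (v - w)\<close>, the second
  because \<open>max R (norm v)\<close> is 1-Lipschitz in \<open>v\<close>; hence the constant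
  2.\<close>

lemma lipschitz_radial_retraction:
  fixes R :: real
  assumes "0 < R"
  shows "2-lipschitz_on UNIV (radial_retraction R :: 'a::real_normed_vector \<Rightarrow> 'a)"
proof (rule lipschitz_onI)
  fix v w :: 'a
  define m n where "m = max R (norm v)" and "n = max R (norm w)"
  have pos: "0 < m" "0 < n" "R \<le> m" "norm w \<le> n"
    using assms by (auto simp: m_def n_def)
  have mn: "\<bar>n - m\<bar> \<le> norm (v - w)"
    using norm_triangle_ineq3[of v w] norm_triangle_ineq3[of w v]
    by (auto simp: m_def n_def max_def norm_minus_commute)
  have "R / m - R / n = R * (n - m) / (m * n)"
    using pos by (simp add: field_simps)
  then have "radial_retraction R v - radial_retraction R w
      = (R / m) *\<^sub>R (v - w) + (R * (n - m) / (m * n)) *\<^sub>R w"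
    by (simp add: radial_retraction_def m_def[symmetric] n_def[symmetric] algebra_simps
        flip: scaleR_left_diff_distrib)
  also have "norm \<dots> \<le> R / m * norm (v - w) + (R * \<bar>n - m\<bar> / (m * n)) * norm w"
    using pos assms by (intro norm_triangle_le) (simp add: abs_mult)
  also have "\<dots> = R / m * norm (v - w) + (R / m) * (norm w / n) * \<bar>n - m\<bar>"
    by simp
  also have "\<dots> \<le> 1 * norm (v - w) + 1 * 1 * norm (v - w)"
    using pos assms mn by (intro add_mono mult_mono) auto
  finally show "dist (radial_retraction R v) (radial_retraction R w) \<le> 2 * dist v w"
    by (simp add: dist_norm)
qed simp

section \<open>Uniqueness, and global existence for Lipschitz nonlinearities\<close>

context singular_kernel
begin

lemma exp_weight:
  assumes "0 \<le> L"
  obtains \<kappa> where "0 \<le> \<kappa>" and "C * exp_kernel_integral \<kappa> * L \<le> 1 / 2"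
proof -
  \<comment> \<open>The added 1 makes the divisor positive even if \<open>C * L = 0\<close>.\<close>
  have pos: "0 < C * L + 1"
    using assms C_nonneg by (simp add: add_nonneg_pos)
  then obtain \<kappa> where \<kappa>: "0 \<le> \<kappa>" "exp_kernel_integral \<kappa> < 1 / (2 * (C * L + 1))"
    using exp_kernel_integral_small[of "1 / (2 * (C * L + 1))"] by auto
  have "(C * L + 1) * exp_kernel_integral \<kappa> \<le> 1 / 2"
    using \<kappa>(2) pos by (simp add: field_simps)
  then have "C * exp_kernel_integral \<kappa> * L \<le> 1 / 2"
    using exp_kernel_integral_nonneg[of \<kappa>] by (simp add: algebra_simps)
  with \<kappa>(1) show thesis
    by (rule that)
qed

text \<open>Both solutions are bounded on the compact interval, so one Lipschitz constant suffices.
  At a maximum point \<open>s0\<close> of the weighted distance \<open>d\<close>, the contraction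
  estimate gives \<open>d s0 \<le> d s0 / 2\<close>; this replaces a Gronwall inequality for
  singular kernels.\<close>

lemma mild_solution_unique:
  assumes \<tau>: "\<tau> \<in> {0..T}" and lip: "\<And>r. \<exists>L. L-lipschitz_on (cball 0 r) G"
    and y: "mild_solution S G f {0..\<tau>} y" and z: "mild_solution S G f {0..\<tau>} z"
    and t: "t \<in> {0..\<tau>}"
  shows "y t = z t"
proof -
  have cont [continuous_intros]: "continuous_on {0..\<tau>} y" "continuous_on {0..\<tau>} z"
    using y z by (auto simp: mild_solution_def)
  obtain My where My: "\<And>s. s \<in> {0..\<tau>} \<Longrightarrow> norm (y s) \<le> My"
    using continuous_on_imp_norm_le[OF cont(1)] by metis
  obtain Mz where Mz: "\<And>s. s \<in> {0..\<tau>} \<Longrightarrow> norm (z s) \<le> Mz"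
    using continuous_on_imp_norm_le[OF cont(2)] by metis
  obtain L where L: "L-lipschitz_on (cball 0 (max My Mz)) G"
    using lip by blast
  have in_ball: "y s \<in> cball 0 (max My Mz)" "z s \<in> cball 0 (max My Mz)" if "s \<in> {0..\<tau>}" for s
    using My[OF that] Mz[OF that] by auto
  have "0 \<le> L"
    using L by (rule lipschitz_on_nonneg)
  then obtain \<kappa> where \<kappa>: "0 \<le> \<kappa>" "C * exp_kernel_integral \<kappa> * L \<le> 1 / 2"
    by (rule exp_weight)
  define d where "d = (\<lambda>s. norm (y s - z s) * exp (- (\<kappa> * s)))"
  have "continuous_on {0..\<tau>} d"
    unfolding d_def by (intro continuous_intros)
  then obtain s0 where s0: "s0 \<in> {0..\<tau>}" "\<And>s. s \<in> {0..\<tau>} \<Longrightarrow> d s \<le> d s0"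
    using continuous_attains_sup[of "{0..\<tau>}" d] \<tau> by auto
  have norm_eq: "norm (y s - z s) = d s * exp (\<kappa> * s)" for s
    by (simp add: d_def exp_minus)
  have sub: "{0..s0} \<subseteq> {0..\<tau>}"
    using s0(1) by auto
  have cont_G: "continuous_on {0..s0} (\<lambda>s. G (y s))" "continuous_on {0..s0} (\<lambda>s. G (z s))"
    using in_ball sub
    by (auto intro!: continuous_on_compose2[OF lipschitz_on_continuous_on[OF L]]
        continuous_on_subset[OF cont(1)] continuous_on_subset[OF cont(2)])
  have "norm (y s0 - z s0) = norm (conv_integral S G y s0 - conv_integral S G z s0)"
    using y z s0(1) by (simp add: mild_solution_def)
  also have "\<dots> \<le> C * exp_kernel_integral \<kappa> * (L * d s0) * exp (\<kappa> * s0)"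
    unfolding conv_integral_eq
  proof (rule norm_conv_diff_le[OF _ cont_G \<kappa>(1)])
    fix s assume "s \<in> {0..s0}"
    then have s: "s \<in> {0..\<tau>}"
      using sub by auto
    have "norm (G (y s) - G (z s)) \<le> L * norm (y s - z s)"
      using lipschitz_onD[OF L in_ball(1,2)[OF s]] by (simp add: dist_norm)
    also have "\<dots> \<le> L * (d s0 * exp (\<kappa> * s))"
      unfolding norm_eq using \<open>0 \<le> L\<close> s0(2)[OF s] by (intro mult_left_mono mult_right_mono) auto
    finally show "norm (G (y s) - G (z s)) \<le> L * d s0 * exp (\<kappa> * s)"
      by simp
  qed (use s0(1) \<tau> in auto)
  finally have "d s0 \<le> (C * exp_kernel_integral \<kappa> * L) * d s0"
    unfolding norm_eq mult_le_cancel_right[of _ "exp (\<kappa> * s0)"] mult.assoc[symmetric]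
    by (simp add: mult_ac)
  also have "\<dots> \<le> 1 / 2 * d s0"
    using \<kappa>(2) by (rule mult_right_mono) (simp add: d_def)
  finally have "d t \<le> 0"
    using s0(2)[OF t] by simp
  then show ?thesis
    by (simp add: d_def mult_le_0_iff)
qed

text \<open>The substitution \<open>x t = exp (\<kappa> * t) *\<^sub>R u t\<close> makes the integral equation a contraction on the
  whole of \<open>{0..T}\<close>.\<close>

lemma mild_solution_exists_global_lipschitz:
  assumes G: "L-lipschitz_on UNIV G" and f: "continuous_on {0..T} f"
  obtains x where "mild_solution S G f {0..T} x"
proof -
  have "0 \<le> L"
    using G by (rule lipschitz_on_nonneg)
  then obtain \<kappa> where \<kappa>: "0 \<le> \<kappa>" "C * exp_kernel_integral \<kappa> * L \<le> 1 / 2"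
    by (rule exp_weight)
  define scale :: "(real \<Rightarrow>\<^sub>C 'v) \<Rightarrow> real \<Rightarrow> 'v"
    where "scale u t = exp (\<kappa> * t) *\<^sub>R apply_bcontfun u t" for u t
  define \<Psi> where "\<Psi> u t = exp (- (\<kappa> * t)) *\<^sub>R (conv_integral S G (scale u) t + f t)" for u t
  have cont_scale: "continuous_on A (scale u)" for A u
    unfolding scale_def by (intro continuous_intros) simp
  have cont_G: "continuous_on A (\<lambda>s. G (scale u s))" for A u
    by (rule continuous_on_compose2[OF lipschitz_on_continuous_on[OF G] cont_scale]) simp
  have "continuous_on (cbox 0 T) (\<Psi> u)" for u
    unfolding \<Psi>_def conv_integral_eq cbox_interval
    by (intro continuous_intros continuous_on_conv cont_G f)
  \<comment> \<open>Bounded continuous functions on the whole line form a complete metric space as a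
    type; \<open>clamp\<close> extends a function on \<open>{0..T}\<close> to that type by
    constants.\<close>
  then have "\<exists>w :: real \<Rightarrow>\<^sub>C 'v. \<forall>t. apply_bcontfun w t = \<Psi> u (clamp 0 T t)" for u
    using continuous_on_cbox_bcontfunE by metis
  then obtain \<Phi> :: "(real \<Rightarrow>\<^sub>C 'v) \<Rightarrow> real \<Rightarrow>\<^sub>C 'v"
    where \<Phi>: "\<And>u t. apply_bcontfun (\<Phi> u) t = \<Psi> u (clamp 0 T t)"
    by metis
  have \<Psi>_contraction: "dist (\<Psi> u t) (\<Psi> v t) \<le> 1 / 2 * dist u v" if t: "t \<in> {0..T}" for u v t
  proof -
    have "norm (conv_integral S G (scale u) t - conv_integral S G (scale v) t)
        \<le> C * exp_kernel_integral \<kappa> * (L * dist u v) * exp (\<kappa> * t)"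
      unfolding conv_integral_eq
    proof (rule norm_conv_diff_le[OF t cont_G cont_G \<kappa>(1)])
      fix s
      have "norm (G (scale u s) - G (scale v s)) \<le> L * norm (scale u s - scale v s)"
        using lipschitz_onD[OF G, of "scale u s" "scale v s"] by (simp add: dist_norm)
      also have "scale u s - scale v s = exp (\<kappa> * s) *\<^sub>R (apply_bcontfun u s - apply_bcontfun v s)"
        by (simp add: scale_def scaleR_diff_right)
      also have "norm \<dots> = exp (\<kappa> * s) * dist (apply_bcontfun u s) (apply_bcontfun v s)"
        by (simp add: dist_norm)
      also have "L * \<dots> \<le> L * (exp (\<kappa> * s) * dist u v)"
        using \<open>0 \<le> L\<close> dist_bounded[of u s v] by (intro mult_left_mono) auto
      finally show "norm (G (scale u s) - G (scale v s)) \<le> L * dist u v * exp (\<kappa> * s)"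
        by (simp add: mult_ac)
    qed
    then have "exp (- (\<kappa> * t)) * norm (conv_integral S G (scale u) t - conv_integral S G (scale v) t)
        \<le> exp (- (\<kappa> * t)) * (C * exp_kernel_integral \<kappa> * (L * dist u v) * exp (\<kappa> * t))"
      by (rule mult_left_mono) simp
    also have "\<dots> = (C * exp_kernel_integral \<kappa> * L) * dist u v"
      by (simp add: exp_minus)
    also have "\<dots> \<le> 1 / 2 * dist u v"
      using \<kappa>(2) by (rule mult_right_mono) simp
    finally show ?thesis
      by (simp add: \<Psi>_def dist_norm flip: scaleR_diff_right)
  qed
  have "\<exists>!u. \<Phi> u = u"
  proof (rule banach_fix_type)
    show "\<forall>u v. dist (\<Phi> u) (\<Phi> v) \<le> 1 / 2 * dist u v"
    proof (intro allI dist_bound)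
      fix u v t
      have "clamp 0 T t \<in> {0..T}"
        using clamp_in_interval[of 0 T t] T_pos by (simp add: cbox_interval)
      then show "dist (apply_bcontfun (\<Phi> u) t) (apply_bcontfun (\<Phi> v) t) \<le> 1 / 2 * dist u v"
        unfolding \<Phi> by (rule \<Psi>_contraction)
    qed
  qed auto
  then obtain u where u: "\<Phi> u = u"
    by blast
  have "mild_solution S G f {0..T} (scale u)"
    unfolding mild_solution_def
  proof safe
    fix t assume "t \<in> {0..T}"
    then have "apply_bcontfun u t = \<Psi> u t"
      using \<Phi>[of u t] clamp_cancel_cbox[of t 0 T] by (simp add: u cbox_interval)
    then show "scale u t = conv_integral S G (scale u) t + f t"
      by (simp add: scale_def[of u t] \<Psi>_def exp_minus)
  qed (rule cont_scale)
  then show thesis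
    by (rule that)
qed

end

section \<open>Continuation of solutions\<close>

locale mild_equation = singular_kernel S T C \<alpha>
  for S :: "real \<Rightarrow> 'w::{banach, second_countable_topology} \<Rightarrow>\<^sub>L 'v::{banach, second_countable_topology}"
    and T C \<alpha> :: real +
  fixes F :: "'v \<Rightarrow> 'w" and f :: "real \<Rightarrow> 'v"
  assumes F_lipschitz: "\<And>r. \<exists>L. L-lipschitz_on (cball 0 r) F"
    and f_continuous: "continuous_on {0..T} f"
begin

text \<open>The solution \<open>z\<close> with \<open>F\<close> truncated outside the ball of radius \<open>R\<close> exists on all of \<open>{0..T}\<close>.
  It provides both the continuation past a time of existence and the limit at the end of a bounded
  solution.\<close>

lemma truncated_solution:
  assumes "0 < R"
  obtains z where "continuous_on {0..T} z"
    and "\<And>\<tau>. \<lbrakk>\<tau> \<in> {0..T}; \<And>s. s \<in> {0..\<tau>} \<Longrightarrow> norm (z s) \<le> R\<rbrakk> \<Longrightarrow> mild_solution S F f {0..\<tau>} z"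
    and "\<And>\<tau> y s. \<lbrakk>\<tau> \<in> {0..T}; mild_solution S F f {0..\<tau>} y;
      \<And>s. s \<in> {0..\<tau>} \<Longrightarrow> norm (y s) \<le> R; s \<in> {0..\<tau>}\<rbrakk> \<Longrightarrow> y s = z s"
proof -
  define G where "G = (\<lambda>v. F (radial_retraction R v))"
  obtain L where L: "L-lipschitz_on (cball 0 R) F"
    using F_lipschitz by blast
  \<comment> \<open>The retraction maps into \<open>cball 0 R\<close>, so the constant
    \<open>L\<close> of \<open>F\<close> on this ball is enough; the factor 2 is that of the
    retraction.\<close>
  have "(L * 2)-lipschitz_on UNIV G"
    unfolding G_def
    by (intro lipschitz_on_compose2 lipschitz_radial_retraction lipschitz_on_subset[OF L])
      (use assms norm_radial_retraction_le in auto)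
  then obtain z where z: "mild_solution S G f {0..T} z"
    using mild_solution_exists_global_lipschitz f_continuous by blast
  have G_eq: "G v = F v" if "norm v \<le> R" for v
    using that assms by (simp add: G_def radial_retraction_id)
  show thesis
  proof
    show "continuous_on {0..T} z"
      using z by (simp add: mild_solution_def)
  next
    fix \<tau> assume "\<tau> \<in> {0..T}" and bound: "\<And>s. s \<in> {0..\<tau>} \<Longrightarrow> norm (z s) \<le> R"
    then have "mild_solution S G f {0..\<tau>} z"
      by (intro mild_solution_subset[OF z]) auto
    then show "mild_solution S F f {0..\<tau>} z"
      by (rule mild_solution_cong) (use bound G_eq in auto)
  next
    fix \<tau> y s
    assume \<tau>: "\<tau> \<in> {0..T}" and y: "mild_solution S F f {0..\<tau>} y"
      and bound: "\<And>s. s \<in> {0..\<tau>} \<Longrightarrow> norm (y s) \<le> R" and s: "s \<in> {0..\<tau>}"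
    from y have y': "mild_solution S G f {0..\<tau>} y"
      by (rule mild_solution_cong) (use bound G_eq in auto)
    have z': "mild_solution S G f {0..\<tau>} z"
      by (rule mild_solution_subset[OF z]) (use \<tau> in auto)
    have "\<exists>L. L-lipschitz_on (cball 0 r) G" for r
      using \<open>(L * 2)-lipschitz_on UNIV G\<close> lipschitz_on_subset by blast
    then show "y s = z s"
      using mild_solution_unique[OF \<tau> _ y' z' s] by blast
  qed
qed

text \<open>Stated with compact intervals, on which a solution is bounded and hence agrees with a
  truncated one.\<close>

definition existence_times :: "real set"
  where "existence_times = {t \<in> {0..T}. \<exists>y. mild_solution S F f {0..t} y}"

lemma existence_timesI: "t \<in> {0..T} \<Longrightarrow> mild_solution S F f {0..t} y \<Longrightarrow> t \<in> existence_times"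
  unfolding existence_times_def by blast

lemma existence_times_subset: "existence_times \<subseteq> {0..T}"
  unfolding existence_times_def by blast

lemma existence_times_down_closed:
  "t \<in> existence_times \<Longrightarrow> 0 \<le> s \<Longrightarrow> s \<le> t \<Longrightarrow> s \<in> existence_times"
  unfolding existence_times_def using mild_solution_subset[of S F f "{0..t}" _ "{0..s}"] by auto

lemma zero_existence_times: "0 \<in> existence_times"
proof (rule existence_timesI)
  show "mild_solution S F f {0..0} (\<lambda>_. f 0)"
    by (simp add: mild_solution_def conv_integral_def set_lebesgue_integral_def)
qed (use T_pos in simp)

text \<open>Truncating at \<open>M + 1\<close> leaves room: the truncated solution equals
  \<open>y\<close> up to \<open>t\<close>, where it is bounded by \<open>M\<close>, and by
  continuity stays below \<open>M + 1\<close> for a short time after \<open>t\<close>.\<close>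

lemma existence_times_extend:
  assumes "t \<in> existence_times" and "t < T"
  obtains t' where "t' \<in> existence_times" and "t < t'"
proof -
  obtain y where t: "t \<in> {0..T}" and y: "mild_solution S F f {0..t} y"
    using assms(1) by (auto simp: existence_times_def)
  obtain M where M: "0 \<le> M" "\<And>s. s \<in> {0..t} \<Longrightarrow> norm (y s) \<le> M"
    using continuous_on_imp_norm_le y by (metis mild_solution_def)
  obtain z where z: "continuous_on {0..T} z"
    "\<And>\<tau>. \<lbrakk>\<tau> \<in> {0..T}; \<And>s. s \<in> {0..\<tau>} \<Longrightarrow> norm (z s) \<le> M + 1\<rbrakk> \<Longrightarrow> mild_solution S F f {0..\<tau>} z"
    "\<And>\<tau> y s. \<lbrakk>\<tau> \<in> {0..T}; mild_solution S F f {0..\<tau>} y;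
      \<And>s. s \<in> {0..\<tau>} \<Longrightarrow> norm (y s) \<le> M + 1; s \<in> {0..\<tau>}\<rbrakk> \<Longrightarrow> y s = z s"
    using truncated_solution[of "M + 1"] M(1) by auto
  have y_bound: "norm (y s) \<le> M + 1" if "s \<in> {0..t}" for s
    using M(2)[OF that] by simp
  have bound: "norm (z s) \<le> M" if "s \<in> {0..t}" for s
    using z(3)[OF t y y_bound that] M(2)[OF that] by simp
  obtain d where d: "0 < d" "\<And>s. s \<in> {0..T} \<Longrightarrow> dist s t < d \<Longrightarrow> dist (z s) (z t) < 1"
    using z(1) t unfolding continuous_on_iff by (metis zero_less_one)
  define t' where "t' = min T (t + d / 2)"
  have t': "t < t'" "t' \<in> {0..T}"
    using assms(2) t d(1) by (auto simp: t'_def)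
  have "norm (z s) \<le> M + 1" if s: "s \<in> {0..t'}" for s
  proof (cases "s \<le> t")
    case True
    then show ?thesis
      using bound[of s] s by simp
  next
    case False
    then have "dist (z s) (z t) < 1"
      using s d(1) by (intro d(2)) (auto simp: t'_def dist_real_def)
    moreover have "norm (z s) \<le> norm (z t) + dist (z s) (z t)"
      using norm_triangle_sub[of "z s" "z t"] by (simp add: dist_norm)
    ultimately show ?thesis
      using bound[of t] t by simp
  qed
  then have "t' \<in> existence_times"
    using t'(2) by (intro existence_timesI[OF _ z(2)])
  with t'(1) show thesis
    by (rule that[rotated])
qed

text \<open>The truncated solution \<open>z\<close> agrees with \<open>y\<close> before
  \<open>\<tau>\<close> and is continuous at \<open>\<tau>\<close> too. The bound therefore passes
  to \<open>\<tau>\<close>, and \<open>z\<close> solves the original equation up to and including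
  \<open>\<tau>\<close>.\<close>

lemma existence_times_bounded_closed:
  assumes \<tau>: "0 < \<tau>" "\<tau> \<le> T" and y: "mild_solution S F f {0..<\<tau>} y"
    and bound: "\<And>s. s \<in> {0..<\<tau>} \<Longrightarrow> norm (y s) \<le> R"
  shows "\<tau> \<in> existence_times"
proof -
  have "0 \<le> R"
    using \<tau>(1) order_trans[OF norm_ge_zero bound[of 0]] by simp
  \<comment> \<open>Radius \<open>R + 1\<close>, since truncation asks for a positive radius and
    \<open>R\<close> may be 0.\<close>
  then obtain z where z: "continuous_on {0..T} z"
    "\<And>\<tau>. \<lbrakk>\<tau> \<in> {0..T}; \<And>s. s \<in> {0..\<tau>} \<Longrightarrow> norm (z s) \<le> R + 1\<rbrakk> \<Longrightarrow> mild_solution S F f {0..\<tau>} z"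
    "\<And>\<tau> y s. \<lbrakk>\<tau> \<in> {0..T}; mild_solution S F f {0..\<tau>} y;
      \<And>s. s \<in> {0..\<tau>} \<Longrightarrow> norm (y s) \<le> R + 1; s \<in> {0..\<tau>}\<rbrakk> \<Longrightarrow> y s = z s"
    using truncated_solution[of "R + 1"] by auto
  have "norm (z s) \<le> R" if s: "s \<in> {0..<\<tau>}" for s
  proof -
    have "mild_solution S F f {0..s} y"
      using s by (intro mild_solution_subset[OF y]) auto
    moreover have "norm (y r) \<le> R + 1" if "r \<in> {0..s}" for r
      using bound[of r] that s by simp
    ultimately have "y s = z s"
      using s \<tau>(2) by (intro z(3)) auto
    with bound[OF s] show ?thesis
      by simp
  qed
  have "norm (z s) \<le> R" if "s \<in> {0..\<tau>}" for s
  proof (rule continuous_on_closure_norm_le[of "{0..<\<tau>}"])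
    show "continuous_on (closure {0..<\<tau>}) z"
      by (rule continuous_on_subset[OF z(1)]) (use \<tau> in simp)
  qed (use that \<tau>(1) \<open>\<And>s. s \<in> {0..<\<tau>} \<Longrightarrow> norm (z s) \<le> R\<close> in auto)
  then have "norm (z s) \<le> R + 1" if "s \<in> {0..\<tau>}" for s
    using that by fastforce
  then show ?thesis
    using \<tau> by (intro existence_timesI[OF _ z(2)]) auto
qed

lemma existence_times_not_singleton: "{0} \<subset> existence_times"
proof -
  obtain t where "t \<in> existence_times" "0 < t"
    using existence_times_extend[OF zero_existence_times T_pos] .
  moreover from this(2) have "t \<notin> {0}"
    by simp
  ultimately show ?thesis
    using zero_existence_times by blast
qed

lemma convex_existence_times: "convex existence_times"
  unfolding is_interval_convex_1[symmetric] is_interval_1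
proof (intro ballI allI impI)
  fix a b x :: real
  assume "a \<in> existence_times" "b \<in> existence_times" "a \<le> x \<and> x \<le> b"
  then show "x \<in> existence_times"
    using existence_times_subset by (intro existence_times_down_closed[of b x]) auto
qed

text \<open>Solutions on the intervals \<open>{0..t}\<close> agree on overlaps by uniqueness, so the
  diagonal choice \<open>Y t t\<close> glues them.\<close>

lemma mild_solution_existence_times:
  obtains x where "mild_solution S F f existence_times x"
proof -
  have "\<forall>t\<in>existence_times. \<exists>y. mild_solution S F f {0..t} y"
    unfolding existence_times_def by blast
  then obtain Y where Y: "\<And>t. t \<in> existence_times \<Longrightarrow> mild_solution S F f {0..t} (Y t)"
    by metis
  define x where "x t = Y t t" for t
  have sol: "mild_solution S F f {0..t} x" if t: "t \<in> existence_times" for t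
  proof (rule mild_solution_cong[OF Y[OF t]])
    fix s assume s: "s \<in> {0..t}"
    then have s_ex: "s \<in> existence_times"
      using existence_times_down_closed[OF t] by auto
    then have "s \<in> {0..T}"
      using existence_times_subset by blast
    moreover have "mild_solution S F f {0..s} (Y t)"
      using s by (intro mild_solution_subset[OF Y[OF t]]) auto
    ultimately show "x s = Y t s"
      unfolding x_def using s
      by (intro mild_solution_unique[OF _ F_lipschitz Y[OF s_ex]]) auto
  qed simp
  have "mild_solution S F f existence_times x"
    unfolding mild_solution_def continuous_on_eq_continuous_within
  proof safe
    fix t assume t: "t \<in> existence_times"
    show "x t = conv_integral S F x t + f t"
      using sol[OF t] t existence_times_subset by (auto simp: mild_solution_def)
    \<comment> \<open>Continuity is local. For \<open>t < T\<close> a time \<open>t'\<close> beyond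
      \<open>t\<close> makes \<open>{0..t'}\<close> a relative neighbourhood of \<open>t\<close>;
      otherwise \<open>t = T\<close> is the last time and \<open>t' = t\<close> works.\<close>
    obtain U t' where U: "open U" "t \<in> U" and t': "t' \<in> existence_times" "t \<le> t'"
      and eq: "existence_times \<inter> U = {0..t'} \<inter> U"
    proof (cases "t < T")
      case True
      then obtain t' where t': "t' \<in> existence_times" "t < t'"
        using existence_times_extend t by blast
      show thesis
        by (rule that[of "{..<t'}" t'])
          (use t' existence_times_subset existence_times_down_closed[OF t'(1)] in auto)
    next
      case False
      show thesis
        by (rule that[of UNIV t])
          (use t False existence_times_subset existence_times_down_closed[OF t] in auto)
    qed
    have "continuous (at t within {0..t'}) x"
      using sol[OF t'(1)] t'(2) t existence_times_subset
      by (auto simp: mild_solution_def continuous_on_eq_continuous_within)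
    moreover have "at t within existence_times = at t within {0..t'}"
      using U eq by (intro at_within_nhd[of t U]) auto
    ultimately show "continuous (at t within existence_times) x"
      by simp
  qed
  then show thesis
    by (rule that)
qed

lemma mild_solution_unique_on:
  assumes "is_interval I" "0 \<in> I" "I \<subseteq> {0..T}"
    and "mild_solution S F f I y" "mild_solution S F f I z" "t \<in> I"
  shows "y t = z t"
proof -
  have "{0..t} \<subseteq> I"
    using mem_is_interval_1_I[OF assms(1,2,6)] by auto
  then have "mild_solution S F f {0..t} y" "mild_solution S F f {0..t} z"
    using assms(4,5) mild_solution_subset by blast+
  moreover have "t \<in> {0..T}"
    using assms(3,6) by blast
  ultimately show ?thesis
    using mild_solution_unique[OF _ F_lipschitz, of t f y z t] by simp
qed

lemma Sup_existence_times_pos: "0 < Sup existence_times"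
proof -
  obtain t where "t \<in> existence_times" "0 < t"
    using existence_times_extend[OF zero_existence_times T_pos] .
  then show ?thesis
    using less_cSup_iff[of existence_times 0] bdd_above_mono[OF bdd_above_Icc existence_times_subset]
    by blast
qed

lemma Sup_existence_times_le: "Sup existence_times \<le> T"
  using existence_times_subset zero_existence_times by (intro cSup_least) auto

lemma Ico_existence_times: "{0..<Sup existence_times} \<subseteq> existence_times"
proof
  fix s assume s: "s \<in> {0..<Sup existence_times}"
  have "existence_times \<noteq> {}" "bdd_above existence_times"
    using zero_existence_times bdd_above_mono[OF bdd_above_Icc existence_times_subset] by auto
  then obtain t where "t \<in> existence_times" "s < t"
    using s less_cSup_iff[of existence_times s] by auto
  then show "s \<in> existence_times"
    using existence_times_down_closed s by simp
qed

text \<open>Boundedness puts the supremum into the set, and \<open>existence_times_extend\<close>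
  would pass beyond a supremum smaller than \<open>T\<close>.\<close>

lemma bounded_imp_existence_times_eq:
  assumes y: "mild_solution S F f existence_times y"
    and bound: "\<And>s. s \<in> existence_times \<Longrightarrow> s < Sup existence_times \<Longrightarrow> norm (y s) \<le> R"
  shows "existence_times = {0..T}"
proof -
  have bdd: "bdd_above existence_times"
    by (rule bdd_above_mono[OF bdd_above_Icc existence_times_subset])
  have Sup_mem: "Sup existence_times \<in> existence_times"
  proof (rule existence_times_bounded_closed[OF Sup_existence_times_pos Sup_existence_times_le])
    show "mild_solution S F f {0..<Sup existence_times} y"
      using y Ico_existence_times by (rule mild_solution_subset)
    show "norm (y s) \<le> R" if "s \<in> {0..<Sup existence_times}" for s
      using bound[of s] Ico_existence_times that by auto
  qed
  have "Sup existence_times = T"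
  proof (rule ccontr)
    assume "Sup existence_times \<noteq> T"
    then have "Sup existence_times < T"
      using Sup_existence_times_le by simp
    then obtain t where "t \<in> existence_times" "Sup existence_times < t"
      using existence_times_extend[OF Sup_mem] by blast
    then show False
      using cSup_upper[OF _ bdd] by fastforce
  qed
  with Sup_mem show ?thesis
    using existence_times_subset existence_times_down_closed by auto
qed

end

section \<open>Finite limit superior, boundedness and blow-up\<close>

text \<open>A finite limit superior controls \<open>g\<close> only near \<open>Sup J\<close>; on the
  remaining compact interval \<open>{0..a}\<close> the bound comes from continuity of
  \<open>y\<close>.\<close>

lemma limsup_left_Sup_finite_imp_bounded:
  fixes y :: "real \<Rightarrow> 'a::real_normed_vector"
  assumes J: "is_interval J" "0 \<in> J" "J \<subseteq> {0..T}" "0 < Sup J"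
    and cont: "continuous_on {0..<Sup J} y"
    and le: "\<And>s. s \<in> J \<Longrightarrow> s < Sup J \<Longrightarrow> norm (y s) \<le> g s"
    and fin: "limsup_left_Sup J g < \<infinity>"
  obtains R where "\<And>s. s \<in> J \<Longrightarrow> s < Sup J \<Longrightarrow> norm (y s) \<le> R"
proof -
  obtain r where r: "0 \<le> r" "limsup_left_Sup J g = ennreal r"
    using fin by (auto simp: less_top_ennreal)
  then have "limsup_left_Sup J g < ennreal (r + 1)"
    by (simp add: ennreal_less_iff)
  then have "\<forall>\<^sub>F s in at (Sup J) within {s \<in> J. s < Sup J}. ennreal (g s) < ennreal (r + 1)"
    unfolding limsup_left_Sup_def by (rule Limsup_lessD)
  then obtain d where d: "0 < d" and
    near: "\<And>s. s \<in> J \<Longrightarrow> s < Sup J \<Longrightarrow> dist s (Sup J) < d \<Longrightarrow> ennreal (g s) < ennreal (r + 1)"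
    unfolding eventually_at by auto
  define a where "a = max 0 (Sup J - d / 2)"
  have a: "0 \<le> a" "a < Sup J" "Sup J - d < a"
    using d J(4) by (auto simp: a_def)
  have "continuous_on {0..a} y"
    by (rule continuous_on_subset[OF cont]) (use a in auto)
  then obtain M where M: "\<And>s. s \<in> {0..a} \<Longrightarrow> norm (y s) \<le> M"
    using continuous_on_imp_norm_le by metis
  show thesis
  proof (rule that[of "max M (r + 1)"])
    fix s assume s: "s \<in> J" "s < Sup J"
    show "norm (y s) \<le> max M (r + 1)"
    proof (cases "s \<le> a")
      case True
      then show ?thesis
        using M[of s] s J(3) by fastforce
    next
      case False
      then have "ennreal (g s) < ennreal (r + 1)"
        using s a by (intro near) (auto simp: dist_real_def)
      then have "g s < r + 1"
        using r(1) ennreal_leI[of "r + 1" "g s"] by (meson not_le)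
      then show ?thesis
        using le[OF s] by simp
    qed
  qed
qed

context mild_equation
begin

text \<open>A general \<open>g\<close> covers both \<open>norm (y s)\<close>, as in (iii), and its
  sum with \<open>1 / (T - s)\<close>, as in (i).\<close>

lemma limsup_finite_imp_existence_times_eq:
  assumes y: "mild_solution S F f existence_times y"
    and le: "\<And>s. s \<in> existence_times \<Longrightarrow> s < Sup existence_times \<Longrightarrow> norm (y s) \<le> g s"
    and fin: "limsup_left_Sup existence_times g < \<infinity>"
  shows "existence_times = {0..T}"
proof -
  have "continuous_on {0..<Sup existence_times} y"
    using y Ico_existence_times unfolding mild_solution_def by (metis continuous_on_subset)
  then obtain R where "\<And>s. s \<in> existence_times \<Longrightarrow> s < Sup existence_times \<Longrightarrow> norm (y s) \<le> R"
    using limsup_left_Sup_finite_imp_bounded[of existence_times T y g] le fin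
      zero_existence_times existence_times_subset Sup_existence_times_pos convex_existence_times
    by (metis is_interval_convex_1)
  then show ?thesis
    by (rule bounded_imp_existence_times_eq[OF y])
qed

text \<open>If the limit superior were finite, the solution would be bounded and the existence times
  would fill \<open>{0..T}\<close>; but then \<open>1 / (T - s)\<close> is unbounded near the
  supremum \<open>T\<close>.\<close>

lemma limsup_blow_up:
  assumes y: "mild_solution S F f existence_times y"
  shows "limsup_left_Sup existence_times (\<lambda>s. 1 / (T - s) + norm (y s)) = \<infinity>"
proof (rule ccontr)
  assume "limsup_left_Sup existence_times (\<lambda>s. 1 / (T - s) + norm (y s)) \<noteq> \<infinity>"
  then have fin: "limsup_left_Sup existence_times (\<lambda>s. 1 / (T - s) + norm (y s)) < \<infinity>"
    by (simp add: less_top)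
  have eq: "existence_times = {0..T}"
    by (rule limsup_finite_imp_existence_times_eq[OF y _ fin]) (use Sup_existence_times_le in auto)
  have Sup_eq: "Sup {0..T} = T"
    using T_pos by simp
  \<comment> \<open>Here the bounded function is \<open>1 / (T - s)\<close> itself, dominated by the
    same sum.\<close>
  obtain R where R: "\<And>s. s \<in> {0..T} \<Longrightarrow> s < T \<Longrightarrow> norm (1 / (T - s)) \<le> R"
  proof (rule limsup_left_Sup_finite_imp_bounded[OF _ _ order_refl _ _ _ fin[unfolded eq],
        where y = "\<lambda>s. 1 / (T - s)", unfolded Sup_eq])
    show "continuous_on {0..<T} (\<lambda>s. 1 / (T - s))"
      by (intro continuous_intros) auto
  qed (use T_pos in auto)
  \<comment> \<open>Chosen so that \<open>1 / (T - s)\<close> is at least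
    \<open>\<bar>R\<bar> + 1\<close>; the \<open>max\<close> keeps \<open>s\<close> in
    \<open>{0..T}\<close>.\<close>
  define s where "s = max 0 (T - 1 / (\<bar>R\<bar> + 1))"
  have s: "s \<in> {0..T}" "s < T" "T - s \<le> 1 / (\<bar>R\<bar> + 1)"
    using T_pos by (auto simp: s_def)
  then have "\<bar>R\<bar> + 1 \<le> 1 / (T - s)"
    by (simp add: field_simps)
  moreover have "1 / (T - s) \<le> R"
    using R[OF s(1,2)] s(2) by simp
  ultimately show False
    by linarith
qed

end

section \<open>From the suprema and infimum to usable bounds\<close>

text \<open>The radius \<open>2 * r\<close> appears because two points of \<open>cball 0 r\<close>
  have norms summing to at most \<open>2 * r\<close>.\<close>

lemma lipschitz_on_cball_of_Sup_finite:
  fixes F :: "'v::real_normed_vector \<Rightarrow> 'w::real_normed_vector"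
  assumes "Sup ({ennreal (norm (F v - F w) / norm (v - w)) | v w. v \<noteq> w \<and> norm v + norm w \<le> 2 * r}
    \<union> {0}) < \<infinity>" (is "Sup ?A < \<infinity>")
  shows "\<exists>L. L-lipschitz_on (cball 0 r) F"
proof -
  obtain L where L: "0 \<le> L" "Sup ?A = ennreal L"
    using assms by (auto simp: less_top_ennreal)
  have "L-lipschitz_on (cball 0 r) F"
  proof (rule lipschitz_onI)
    fix v w :: 'v
    assume vw: "v \<in> cball 0 r" "w \<in> cball 0 r"
    show "dist (F v) (F w) \<le> L * dist v w"
    proof (cases "v = w")
      case False
      then have "ennreal (norm (F v - F w) / norm (v - w)) \<in> ?A"
        using vw by fastforce
      then have "ennreal (norm (F v - F w) / norm (v - w)) \<le> ennreal L"
        unfolding L(2)[symmetric] by (rule Sup_upper)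
      then have "norm (F v - F w) / norm (v - w) \<le> L"
        using L(1) by (simp add: ennreal_le_iff)
      then show ?thesis
        using False by (simp add: dist_norm divide_le_eq)
    qed simp
  qed (rule L(1))
  then show ?thesis
    by blast
qed

text \<open>The weight sits at the smaller time. Writing it with \<open>min s u\<close> treats both
  sides of \<open>u\<close> at once, and it stays bounded near \<open>u > 0\<close>.\<close>

lemma continuous_on_of_weighted_Hoelder:
  fixes S :: "real \<Rightarrow> 'a::real_normed_vector"
  assumes "0 < \<rho>"
    and H: "\<And>s t. 0 < s \<Longrightarrow> s < t \<Longrightarrow> t < T \<Longrightarrow> norm (S t - S s) \<le> C * s powr - \<alpha> * (t - s) powr \<rho>"
  shows "continuous_on {0<..<T} S"
  unfolding continuous_on
proof
  fix u assume u: "u \<in> {0<..<T}"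
  have "((\<lambda>s. C * min s u powr - \<alpha> * \<bar>s - u\<bar> powr \<rho>) \<longlongrightarrow> C * min u u powr - \<alpha> * 0)
      (at u within {0<..<T})"
  proof (intro tendsto_intros tendsto_zero_powrI)
    show "((\<lambda>s. \<bar>s - u\<bar>) \<longlongrightarrow> 0) (at u within {0<..<T})"
      by (auto intro!: tendsto_eq_intros)
  qed (use u assms(1) in auto)
  then have lim: "((\<lambda>s. C * min s u powr - \<alpha> * \<bar>s - u\<bar> powr \<rho>) \<longlongrightarrow> 0) (at u within {0<..<T})"
    by simp
  have "norm (S s - S u) \<le> C * min s u powr - \<alpha> * \<bar>s - u\<bar> powr \<rho>" if "s \<in> {0<..<T}" for s
    using H[of s u] H[of u s] that u by (cases s u rule: linorder_cases) (auto simp: norm_minus_commute)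
  then have "\<forall>\<^sub>F s in at u within {0<..<T}. norm (S s - S u) \<le> C * min s u powr - \<alpha> * \<bar>s - u\<bar> powr \<rho>"
    by (simp add: eventually_at_filter)
  then have "((\<lambda>s. S s - S u) \<longlongrightarrow> 0) (at u within {0<..<T})"
    using lim by (rule Lim_null_comparison)
  then show "(S \<longlongrightarrow> S u) (at u within {0<..<T})"
    by (rule LIM_zero_cancel)
qed

text \<open>A finite infimum yields one pair of exponents with finite supremum \<open>C\<close>.
  Both summands are nonnegative, so each is bounded separately: one bounds \<open>S\<close>, the
  other gives its continuity.\<close>

lemma singular_kernel_of_INF_finite:
  fixes S :: "real \<Rightarrow> 'w::{banach, second_countable_topology} \<Rightarrow>\<^sub>L 'v::{banach, second_countable_topology}"
  assumes "0 < T"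
    and "(INF (\<alpha>, \<rho>) \<in> {0<..<1} \<times> {0<..<1::real}. SUP s\<in>{0<..<T}. SUP t\<in>{s<..<T}.
      ennreal (s powr \<alpha> * (norm (S s) + norm (S t - S s) * \<bar>t - s\<bar> powr (- \<rho>)))) < \<infinity>"
  obtains C \<alpha> where "singular_kernel S T C \<alpha>"
proof -
  obtain \<alpha> \<rho> :: real where \<alpha>: "\<alpha> < 1" and \<rho>: "0 < \<rho>"
    and "(SUP s\<in>{0<..<T}. SUP t\<in>{s<..<T}.
      ennreal (s powr \<alpha> * (norm (S s) + norm (S t - S s) * \<bar>t - s\<bar> powr (- \<rho>)))) < \<infinity>"
    (is "?SUP < \<infinity>")
    using assms(2) unfolding INF_less_iff by auto
  then obtain C where C: "0 \<le> C" "?SUP = ennreal C"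
    by (auto simp: less_top_ennreal)
  have le: "norm (S s) + norm (S t - S s) * (t - s) powr - \<rho> \<le> C * s powr - \<alpha>"
    if "0 < s" "s < t" "t < T" for s t
  proof -
    have "ennreal (s powr \<alpha> * (norm (S s) + norm (S t - S s) * \<bar>t - s\<bar> powr - \<rho>)) \<le> ?SUP"
      using that by (intro SUP_upper2[of s] SUP_upper2[of t]) auto
    then have "s powr \<alpha> * (norm (S s) + norm (S t - S s) * (t - s) powr - \<rho>) \<le> C"
      unfolding C(2) using C(1) that by (simp add: ennreal_le_iff)
    then show ?thesis
      using that by (simp add: powr_minus field_simps)
  qed
  have "continuous_on {0<..<T} S"
  proof (rule continuous_on_of_weighted_Hoelder[OF \<rho>])
    fix s t :: real assume st: "0 < s" "s < t" "t < T"
    have "norm (S t - S s) * (t - s) powr - \<rho> \<le> C * s powr - \<alpha>"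
      using le[OF st] norm_ge_zero[of "S s"] by linarith
    then show "norm (S t - S s) \<le> C * s powr - \<alpha> * (t - s) powr \<rho>"
      using st by (simp add: powr_minus[of _ \<rho>] field_simps)
  qed
  \<comment> \<open>The norm of \<open>S s\<close> occurs only under the supremum over
    \<open>t\<close>, so some \<open>t\<close> strictly between \<open>s\<close> and
    \<open>T\<close> has to be supplied.\<close>
  moreover have "norm (S s) \<le> C * s powr - \<alpha>" if "s \<in> {0<..<T}" for s
  proof -
    have "s < T"
      using that by simp
    then obtain t where t: "s < t" "t < T"
      using dense by blast
    show ?thesis
      by (rule order_trans[OF _ le[of s t]]) (use that t in simp_all)
  qed
  ultimately show thesis
    using assms(1) \<alpha> by (intro that) (unfold_locales, auto)
qed

section \<open>The unique maximal interval of existence\<close>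

theorem theorem1p1:
  fixes T :: real
    and F :: "'v::{banach, second_countable_topology} \<Rightarrow> 'w::{banach, second_countable_topology}"
    and f :: "real \<Rightarrow> 'v"
    and S :: "real \<Rightarrow> 'w \<Rightarrow>\<^sub>L 'v"
    and \<S> :: "real \<Rightarrow> 'v \<Rightarrow>\<^sub>L 'v"
  assumes "0 < T"
    and "continuous_on UNIV F"
    and "continuous_on {0..T} f"
    and "S \<in> measurable (restrict_space borel {0<..<T}) borel"
    and "\<S> \<in> measurable (restrict_space borel {0..T}) borel"
    and "\<And>v. continuous_on {0..T} (\<lambda>t. blinfun_apply (\<S> t) v)"
    and "\<And>t1 t2. t1 \<in> {0..<T} \<Longrightarrow> t2 \<in> {0<..<T - t1} \<Longrightarrow> S (t1 + t2) = \<S> t1 o\<^sub>L S t2"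
    and "\<And>r::real. 0 \<le> r \<Longrightarrow>
      Sup ({ennreal (norm (F v - F w) / norm (v - w)) | v w. v \<noteq> w \<and> norm v + norm w \<le> r} \<union> {0})
      + (INF (\<alpha>, \<rho>) \<in> {0<..<1} \<times> {0<..<1::real}. SUP s\<in>{0<..<T}. SUP t\<in>{s<..<T}.
          ennreal (s powr \<alpha> * (norm (S s) + norm (S t - S s) * \<bar>t - s\<bar> powr (- \<rho>))))
      < \<infinity>"
  shows "\<exists>!J. convex J \<and> J \<subseteq> {0..T} \<and> {0} \<subset> J \<and>
    (\<exists>!x. maximal_solution T S F f J x) \<and>
    (\<forall>x. maximal_solution T S F f J x \<longrightarrow>
      (\<forall>I y. convex I \<and> I \<subseteq> {0..T} \<and> y \<in> cont_maps I UNIV \<and> J \<subseteq> I \<and>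
        (\<forall>t\<in>I. conv_norm_integral S F y t < \<infinity>) \<and>
        (\<forall>t\<in>I. y t = conv_integral S F y t + f t) \<longrightarrow>
        I = J \<and> x = y)) \<and>
    (\<forall>y. y \<in> cont_maps J UNIV \<and>
        (\<forall>t\<in>J. conv_norm_integral S F y t < \<infinity>) \<and>
        (\<forall>t\<in>J. y t = conv_integral S F y t + f t) \<and>
        limsup_left_Sup J (\<lambda>s. norm (y s)) < \<infinity> \<longrightarrow>
      J = {0..T})"
proof -
  have lip: "\<exists>L. L-lipschitz_on (cball 0 r) F" for r
  proof (cases "0 \<le> r")
    case True
    then show ?thesis
      using assms(8)[of "2 * r"] by (intro lipschitz_on_cball_of_Sup_finite) auto
  next
    case False
    then show ?thesis
      by (intro exI[of _ 0]) (simp add: lipschitz_on_def)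
  qed
  \<comment> \<open>The infimum does not depend on \<open>r\<close>: take \<open>r = 0\<close> and
    drop the nonnegative first summand.\<close>
  obtain C \<alpha> where "singular_kernel S T C \<alpha>"
    using singular_kernel_of_INF_finite[OF assms(1), of S]
      order.strict_trans1[OF add_increasing[OF zero_le order_refl] assms(8)[OF order_refl]]
    by metis
  then interpret mild_equation S T C \<alpha> F f
    using lip assms(3) by (simp add: mild_equation_def mild_equation_axioms_def)
  \<comment> \<open>Members of \<open>cont_maps\<close> are extensional, so agreement on
    \<open>I\<close> becomes equality of functions.\<close>
  have unique: "y = z"
    if "convex I" "0 \<in> I" "I \<subseteq> {0..T}" "mild_solution S F f I y" "mild_solution S F f I z"
      "y \<in> cont_maps I UNIV" "z \<in> cont_maps I UNIV" for I y z
  proof (rule extensionalityI[of _ I])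
    show "y \<in> extensional I" "z \<in> extensional I"
      using that by (auto simp: cont_maps_def PiE_def)
    show "y t = z t" if "t \<in> I" for t
      using \<open>convex I\<close> \<open>0 \<in> I\<close> \<open>I \<subseteq> {0..T}\<close> \<open>mild_solution S F f I y\<close> \<open>mild_solution S F f I z\<close> that
      by (intro mild_solution_unique_on[of I y z]) (simp_all add: is_interval_convex_1)
  qed
  have mild: "mild_solution S F f I y"
    if "y \<in> cont_maps I UNIV" "\<forall>t\<in>I. y t = conv_integral S F y t + f t" for I y
    using that by (simp add: mild_solution_def cont_maps_def)
  \<comment> \<open>Every interval carrying a solution lies in \<open>existence_times\<close>; this
    gives maximality in (ii) and one half of the uniqueness of \<open>J\<close>.\<close>
  have subset: "I \<subseteq> existence_times"
    if "convex I" "0 \<in> I" "I \<subseteq> {0..T}" "mild_solution S F f I y" for I y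
  proof
    fix t assume t: "t \<in> I"
    then have "{0..t} \<subseteq> I"
      using mem_is_interval_1_I[of I 0 t] that by (auto simp: is_interval_convex_1)
    then show "t \<in> existence_times"
      using that(3,4) t by (intro existence_timesI[OF _ mild_solution_subset]) auto
  qed
  obtain x0 where x0: "mild_solution S F f existence_times x0"
    using mild_solution_existence_times .
  \<comment> \<open>The glued solution is arbitrary off its interval; restriction makes it a member
    of \<open>cont_maps\<close>.\<close>
  define x where "x = restrict x0 existence_times"
  have x_cont: "x \<in> cont_maps existence_times UNIV"
    using x0 continuous_on_cong[of existence_times existence_times x x0]
    by (auto simp: x_def cont_maps_def mild_solution_def)
  have x_mild: "mild_solution S F f existence_times x"
  proof (rule mild[OF x_cont], rule ballI)
    fix t assume t: "t \<in> existence_times"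
    then have "conv_integral S F x t = conv_integral S F x0 t"
      by (intro conv_integral_cong) (auto simp: x_def intro: existence_times_down_closed)
    then show "x t = conv_integral S F x t + f t"
      using x0 t by (simp add: mild_solution_def x_def)
  qed
  have x_finite: "conv_norm_integral S F x t < \<infinity>" if t: "t \<in> existence_times" for t
  proof (rule conv_norm_integral_finite)
    show "continuous_on {0..t} (\<lambda>s. F (x s))"
    proof (rule continuous_on_compose2[OF assms(2)])
      show "continuous_on {0..t} x"
        using x_mild unfolding mild_solution_def
        by (elim conjE continuous_on_subset) (simp add: subset_iff existence_times_down_closed[OF t])
    qed simp
  qed (use t existence_times_subset in blast)
  \<comment> \<open>The limit superior is infinite, so the strict inequality in (i) amounts to
    finiteness of the integral.\<close>
  have x_maximal: "maximal_solution T S F f existence_times x"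
    using x_cont x_mild x_finite limsup_blow_up[OF x_mild]
    by (simp add: maximal_solution_def mild_solution_def)
  have maximal_mild: "y \<in> cont_maps I UNIV \<and> mild_solution S F f I y"
    if "maximal_solution T S F f I y" for I y
    using that mild[of y I] by (auto simp: maximal_solution_def)
  note E = convex_existence_times zero_existence_times existence_times_subset
  show ?thesis
  proof (rule ex1I[of _ existence_times], intro conjI allI impI; (elim conjE)?)
    show "convex existence_times" "existence_times \<subseteq> {0..T}" "{0} \<subset> existence_times"
      using E existence_times_not_singleton by auto
    show "\<exists>!x. maximal_solution T S F f existence_times x"
      using x_maximal unique[OF E] maximal_mild by (metis (no_types))
  next
    fix y I z
    assume y: "maximal_solution T S F f existence_times y"
      and I: "convex I" "I \<subseteq> {0..T}" "existence_times \<subseteq> I"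
      and z: "z \<in> cont_maps I UNIV" "\<forall>t\<in>I. z t = conv_integral S F z t + f t"
    show I_eq: "I = existence_times"
      using subset[of I z] I zero_existence_times mild[OF z] by blast
    show "y = z"
      using unique[OF E] maximal_mild[OF y] z mild[OF z] unfolding I_eq by blast
  next
    fix y
    assume y: "y \<in> cont_maps existence_times UNIV"
        "\<forall>t\<in>existence_times. y t = conv_integral S F y t + f t"
      and fin: "limsup_left_Sup existence_times (\<lambda>s. norm (y s)) < \<infinity>"
    show "existence_times = {0..T}"
      by (rule limsup_finite_imp_existence_times_eq[OF mild[OF y] _ fin]) simp
  next
    fix J
    assume J: "convex J" "J \<subseteq> {0..T}" "{0} \<subset> J" "\<exists>!x. maximal_solution T S F f J x"
      and extension: "\<forall>x. maximal_solution T S F f J x \<longrightarrow>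
        (\<forall>I y. convex I \<and> I \<subseteq> {0..T} \<and> y \<in> cont_maps I UNIV \<and> J \<subseteq> I \<and>
          (\<forall>t\<in>I. conv_norm_integral S F y t < \<infinity>) \<and>
          (\<forall>t\<in>I. y t = conv_integral S F y t + f t) \<longrightarrow> I = J \<and> x = y)"
    obtain y where y: "maximal_solution T S F f J y"
      using J(4) by blast
    then have "J \<subseteq> existence_times"
      using subset[of J y] maximal_mild[OF y] J by blast
    moreover have "\<forall>t\<in>existence_times. x t = conv_integral S F x t + f t"
      using x_mild by (simp add: mild_solution_def)
    \<comment> \<open>Property (ii) of \<open>J\<close>, applied to the larger interval
      \<open>existence_times\<close> and its solution \<open>x\<close>, forces equality.\<close>
    ultimately have "existence_times = J"
      using extension[rule_format, OF y, of existence_times x] E x_cont x_finite by blast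
    then show "J = existence_times"
      by simp
  qed
qed

end
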